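(* Let $\tau$ be a Hausdorff locally compact topology on the bicyclic monoid with adjoined zero $\mathscr{C}^0=\mathscr{C}(p,q)\sqcup\{0\}$ such that $(\mathscr{C}^0,\tau)$ is a semitopological semigroup. Then either $(\mathscr{C}^0,\tau)$ is discrete or $(\mathscr{C}^0,\tau)$ is topologically isomorphic to $(\mathscr{C}^0,\tau_{\mathsf{Ac}})$.
   Context: The bicyclic monoid $\mathscr{C}(p,q)$ is the monoid with identity $1$ generated by two elements $p,q$ subject to the single relation $pq=1$; its elements are exactly the pairwise distinct elements $q^ip^j$, $i,j\geq 0$. $\mathscr{C}^0=\mathscr{C}(p,q)\sqcup\{0\}$ is the bicyclic monoid with an adjoined zero $0$ (so $0\cdot x=x\cdot 0=0$ for all $x$). A semitopological semigroup is a semigroup with a topology for which the multiplication is separately continuous. A space is locally compact if every point has an open neighbourhood with compact closure. $\tau_{\mathsf{Ac}}$ is the topology on $\mathscr{C}^0$ in which every element of $\mathscr{C}(p,q)$ is an isolated point and the sets $U\subseteq\mathscr{C}^0$ with $0\in U$ and $\mathscr{C}(p,q)\setminus U$ finite form a base at $0$ (the one-point compactification of the discrete space $\mathscr{C}(p,q)$ with remainder $\{0\}$). Topologically isomorphic means that there is a semigroup isomorphism which is a homeomorphism. *)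

theory Defs
  imports "HOL-Analysis.Analysis"
begin

section \<open>The bicyclic monoid\<close>

text \<open>The monoid presented by generators \<open>p\<close>, \<open>q\<close> and the relation \<open>pq = 1\<close>: words in the two
  letters modulo the least congruence of the free monoid that identifies \<open>pq\<close> with the empty word.\<close>

datatype bicyclic_gen = GenP | GenQ

inductive bicyclic_cong :: "bicyclic_gen list \<Rightarrow> bicyclic_gen list \<Rightarrow> bool" where
  base: "bicyclic_cong [GenP, GenQ] []"
| refl: "bicyclic_cong u u"
| sym: "bicyclic_cong u v \<Longrightarrow> bicyclic_cong v u"
| trans: "bicyclic_cong u v \<Longrightarrow> bicyclic_cong v w \<Longrightarrow> bicyclic_cong u w"
| append: "bicyclic_cong u u' \<Longrightarrow> bicyclic_cong v v' \<Longrightarrow> bicyclic_cong (u @ v) (u' @ v')"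

quotient_type bicyclic = "bicyclic_gen list" / bicyclic_cong
  by (rule equivpI)
     (auto intro!: reflpI sympI transpI intro: bicyclic_cong.refl bicyclic_cong.sym bicyclic_cong.trans)

instantiation bicyclic :: monoid_mult
begin

lift_definition one_bicyclic :: bicyclic is "[]" .

lift_definition times_bicyclic :: "bicyclic \<Rightarrow> bicyclic \<Rightarrow> bicyclic" is "(@)"
  by (rule bicyclic_cong.append)

instance
  by standard (transfer, simp add: bicyclic_cong.refl)+

end

lift_definition bic_p :: bicyclic is "[GenP]" .
lift_definition bic_q :: bicyclic is "[GenQ]" .

lemma bic_p_bic_q: "bic_p * bic_q = 1"
  by transfer (simp add: bicyclic_cong.base)

lemma bic_p_power_bic_q: "bic_p ^ Suc j * bic_q = bic_p ^ j"
  by (simp only: power_Suc2 mult.assoc bic_p_bic_q mult_1_right)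

lemma bicyclic_normal_form_ex: "\<exists>i j. x = bic_q ^ i * bic_p ^ j"
proof -
  have step: "\<exists>i j. abs_bicyclic u = bic_q ^ i * bic_p ^ j" for u
  proof (induction u rule: rev_induct)
    case Nil
    have "abs_bicyclic [] = bic_q ^ 0 * bic_p ^ 0"
      by (simp only: one_bicyclic.abs_eq[symmetric] power_0 mult_1_left)
    then show ?case by blast
  next
    case (snoc a u)
    then obtain i j where u: "abs_bicyclic u = bic_q ^ i * bic_p ^ j" by blast
    have split: "abs_bicyclic (u @ [b]) = abs_bicyclic u * abs_bicyclic [b]" for b
      by (simp add: times_bicyclic.abs_eq)
    show ?case
    proof (cases a)
      case GenP
      then have "abs_bicyclic (u @ [a]) = bic_q ^ i * bic_p ^ Suc j"
        by (simp only: split u bic_p.abs_eq[symmetric] power_Suc2 mult.assoc)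
      then show ?thesis by blast
    next
      case GenQ
      then have a: "abs_bicyclic (u @ [a]) = bic_q ^ i * (bic_p ^ j * bic_q)"
        by (simp only: split u bic_q.abs_eq[symmetric] mult.assoc)
      show ?thesis
      proof (cases j)
        case 0
        then have "abs_bicyclic (u @ [a]) = bic_q ^ Suc i * bic_p ^ 0"
          by (simp only: a power_Suc2 power_0 mult_1_left mult_1_right)
        then show ?thesis by blast
      next
        case (Suc k)
        then have "abs_bicyclic (u @ [a]) = bic_q ^ i * bic_p ^ k"
          by (simp only: a bic_p_power_bic_q)
        then show ?thesis by blast
      qed
    qed
  qed
  show ?thesis
    using step[of "rep_bicyclic x"] by (simp only: Quotient3_abs_rep[OF Quotient3_bicyclic])
qed

text \<open>A representation by self-maps of \<open>nat\<close> that separates the normal forms.\<close>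

fun gen_act :: "bicyclic_gen \<Rightarrow> nat \<Rightarrow> nat" where
  "gen_act GenP n = n - 1"
| "gen_act GenQ n = Suc n"

lift_definition bicyclic_act :: "bicyclic \<Rightarrow> nat \<Rightarrow> nat" is "foldr gen_act"
proof -
  fix u v
  assume "bicyclic_cong u v"
  then show "foldr gen_act u = foldr gen_act v"
    by induction (auto simp: fun_eq_iff)
qed

lemma bicyclic_act_mult: "bicyclic_act (x * y) n = bicyclic_act x (bicyclic_act y n)"
  by transfer simp

lemma bicyclic_act_one: "bicyclic_act 1 n = n"
  by transfer simp

lemma bicyclic_act_q_power: "bicyclic_act (bic_q ^ i) n = n + i"
proof (induction i)
  case (Suc i)
  have "bicyclic_act bic_q m = Suc m" for m by transfer simp
  with Suc show ?case by (simp add: bicyclic_act_mult)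
qed (simp add: bicyclic_act_one)

lemma bicyclic_act_p_power: "bicyclic_act (bic_p ^ j) n = n - j"
proof (induction j)
  case (Suc j)
  have "bicyclic_act bic_p m = m - 1" for m by transfer simp
  with Suc show ?case by (simp add: bicyclic_act_mult)
qed (simp add: bicyclic_act_one)

lemma bicyclic_normal_form_unique:
  "bic_q ^ i * bic_p ^ j = bic_q ^ i' * bic_p ^ j' \<longleftrightarrow> i = i' \<and> j = j'"
proof
  assume eq: "bic_q ^ i * bic_p ^ j = bic_q ^ i' * bic_p ^ j'"
  have act: "n - j + i = n - j' + i'" for n
    using arg_cong[OF eq, of "\<lambda>x. bicyclic_act x n"]
    by (simp add: bicyclic_act_mult bicyclic_act_q_power bicyclic_act_p_power)
  from act[of 0] act[of "j + j'"] show "i = i' \<and> j = j'" by simp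
qed simp


section \<open>Adjoining a zero\<close>

text \<open>A new zero is adjoined unconditionally, even if \<open>'a\<close> already has one.\<close>

datatype 'a with_zero = Zero | Elem 'a

instantiation with_zero :: (semigroup_mult) "{semigroup_mult, mult_zero}"
begin

definition zero_with_zero :: "'a with_zero" where
  "0 = Zero"

definition times_with_zero :: "'a with_zero \<Rightarrow> 'a with_zero \<Rightarrow> 'a with_zero" where
  "x * y = (case x of Zero \<Rightarrow> Zero | Elem a \<Rightarrow>
             (case y of Zero \<Rightarrow> Zero | Elem b \<Rightarrow> Elem (a * b)))"

instance
  by standard (auto simp: times_with_zero_def zero_with_zero_def mult.assoc split: with_zero.splits)

end

type_synonym bicyclic0 = "bicyclic with_zero"


section \<open>Topologies\<close>

definition semitopological_semigroup :: "'a::semigroup_mult topology \<Rightarrow> bool" where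
  "semitopological_semigroup X \<longleftrightarrow>
     topspace X = UNIV \<and>
     (\<forall>a. continuous_map X X (\<lambda>x. a * x) \<and> continuous_map X X (\<lambda>x. x * a))"

definition topologically_isomorphic ::
    "'a::semigroup_mult topology \<Rightarrow> 'b::semigroup_mult topology \<Rightarrow> bool" where
  "topologically_isomorphic X Y \<longleftrightarrow>
     (\<exists>h. bij h \<and> (\<forall>x y. h (x * y) = h x * h y) \<and> homeomorphic_map X Y h)"

definition tau_Ac :: "bicyclic0 topology" where
  "tau_Ac = topology (\<lambda>U. 0 \<in> U \<longrightarrow> finite (range Elem - U))"

lemma openin_tau_Ac: "openin tau_Ac U \<longleftrightarrow> (0 \<in> U \<longrightarrow> finite (range Elem - U))"
proof -
  have "istopology (\<lambda>U::bicyclic0 set. 0 \<in> U \<longrightarrow> finite (range Elem - U))"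
    unfolding istopology_def
    by (auto simp: Diff_Int intro: rev_finite_subset)
  then show ?thesis
    by (simp add: tau_Ac_def)
qed

lemma topspace_tau_Ac: "topspace tau_Ac = UNIV"
  unfolding topspace_def by (auto simp: openin_tau_Ac intro!: exI[of _ UNIV])

text \<open>In the Hausdorff case, the library's local compactness is the existence of open
  neighbourhoods with compact closure.\<close>

lemma locally_compact_space_iff_compact_closure:
  assumes "Hausdorff_space X"
  shows "locally_compact_space X \<longleftrightarrow>
    (\<forall>x\<in>topspace X. \<exists>U. openin X U \<and> x \<in> U \<and> compactin X (X closure_of U))"
proof
  assume L: "locally_compact_space X"
  show "\<forall>x\<in>topspace X. \<exists>U. openin X U \<and> x \<in> U \<and> compactin X (X closure_of U)"
  proof
    fix x assume "x \<in> topspace X"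
    then obtain U K where UK: "openin X U" "compactin X K" "x \<in> U" "U \<subseteq> K"
      using L unfolding locally_compact_space_def by blast
    have "X closure_of U \<subseteq> K"
      using UK assms by (simp add: closure_of_minimal compactin_imp_closedin)
    then have "compactin X (X closure_of U)"
      using UK(2) closed_compactin closedin_closure_of by blast
    with UK show "\<exists>U. openin X U \<and> x \<in> U \<and> compactin X (X closure_of U)" by blast
  qed
next
  assume "\<forall>x\<in>topspace X. \<exists>U. openin X U \<and> x \<in> U \<and> compactin X (X closure_of U)"
  then show "locally_compact_space X"
    unfolding locally_compact_space_def
    by (meson closure_of_subset openin_subset)
qed

end

theory Submission
  imports Defs
begin

text \<open>
  Left multiplication by the idempotent \<open>q\<^sup>n p\<^sup>n\<close> fixes \<open>q\<^sup>i p\<^sup>j\<close> exactly when \<open>n \<le> i\<close>, and right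
  multiplication fixes it exactly when \<open>n \<le> j\<close>. In a Hausdorff topology the fixed point set of a
  translation is closed, so the elements moved by \<open>q\<^sup>n p\<^sup>n\<close> from the left and by \<open>q\<^sup>m p\<^sup>m\<close> from
  the right form an open set. It is finite, and every nonzero element lies in such a set for
  suitable \<open>n\<close> and \<open>m\<close>; hence all nonzero elements are isolated.

  Thus only the neighbourhoods of \<open>0\<close> are in question. Let \<open>U\<close> be an open neighbourhood of \<open>0\<close>
  inside a compact set. Away from a neighbourhood \<open>V\<close> of \<open>0\<close> the compact set has only isolated points
  and is therefore finite, so \<open>U - V\<close> is finite for every \<open>V\<close>. Taking for \<open>V\<close> the preimage of \<open>U\<close> under
  a translation, which contains \<open>0\<close> because the translation fixes \<open>0\<close>, shows that each
  translation maps all but finitely many elements of \<open>U\<close> back into \<open>U\<close>.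

  Place \<open>q\<^sup>i p\<^sup>j\<close> at the point \<open>(i, j)\<close> of the quarter plane grid. The left translations by \<open>q\<close> and
  \<open>p\<close> and the right translations by \<open>p\<close> and \<open>q\<close> move along the four directions of the grid, so only
  finitely many edges of the grid leave \<open>U\<close>. The grid has one end (\<open>grid_one_ended\<close>): \<open>U\<close> is
  finite or cofinite. If \<open>U\<close> is finite, then \<open>0\<close> is isolated as well and the topology is discrete.
  If \<open>U\<close> is cofinite, then so are all neighbourhoods of \<open>0\<close>, and the topology is
  \<open>\<tau>\<^sub>A\<^sub>c\<close> itself.
\<close>

section \<open>Coordinates on the bicyclic monoid with zero\<close>

definition qp :: "nat \<Rightarrow> nat \<Rightarrow> bicyclic0" where
  "qp i j = Elem (bic_q ^ i * bic_p ^ j)"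

lemma qp_eq_iff [simp]: "qp i j = qp k l \<longleftrightarrow> i = k \<and> j = l"
  by (simp add: qp_def bicyclic_normal_form_unique)

lemma qp_nonzero [simp]: "qp i j \<noteq> 0"
  by (simp add: qp_def zero_with_zero_def)

lemma zero_or_qp:
  obtains "x = 0" | i j where "x = qp i j"
  by (metis bicyclic_normal_form_ex qp_def with_zero.exhaust zero_with_zero_def)

lemma Elem_mult: "Elem a * Elem b = Elem (a * b)"
  by (simp add: times_with_zero_def)

lemma bic_p_power_q_power: "bic_p ^ n * bic_q ^ n = 1"
proof (induction n)
  case (Suc n)
  have "bic_p ^ Suc n * bic_q ^ Suc n = bic_p ^ n * (bic_p * bic_q) * bic_q ^ n"
    by (simp only: power_Suc2[of bic_p] power_Suc[of bic_q] mult.assoc)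
  then show ?case by (simp add: bic_p_bic_q Suc)
qed simp

lemma q_mult_qp: "Elem bic_q * qp i j = qp (Suc i) j"
  by (simp add: qp_def Elem_mult mult.assoc)

lemma p_mult_qp: "Elem bic_p * qp (Suc i) j = qp i j"
  by (simp add: qp_def Elem_mult bic_p_bic_q flip: mult.assoc)

lemma qp_mult_p: "qp i j * Elem bic_p = qp i (Suc j)"
  by (simp only: qp_def Elem_mult mult.assoc power_Suc2)

lemma qp_mult_q: "qp i (Suc j) * Elem bic_q = qp i j"
  by (simp only: qp_def Elem_mult mult.assoc bic_p_power_bic_q)

lemma idempotent_mult_qp: "qp n n * qp i j = qp (max n i) (j + (n - i))"
proof (cases "i \<le> n")
  case True
  then obtain d where d: "n = d + i" by (metis le_add_diff_inverse2)
  have "bic_q ^ n * bic_p ^ n * (bic_q ^ i * bic_p ^ j)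
      = bic_q ^ n * (bic_p ^ d * (bic_p ^ i * bic_q ^ i) * bic_p ^ j)"
    unfolding d power_add[of bic_p] by (simp only: mult.assoc)
  also have "\<dots> = bic_q ^ n * bic_p ^ (j + d)"
    by (simp add: bic_p_power_q_power add.commute flip: power_add)
  finally show ?thesis using d by (simp add: qp_def Elem_mult)
next
  case False
  then obtain d where d: "i = n + d" by (metis nat_le_linear le_add_diff_inverse)
  have "bic_q ^ n * bic_p ^ n * (bic_q ^ i * bic_p ^ j)
      = bic_q ^ n * (bic_p ^ n * bic_q ^ n * bic_q ^ d) * bic_p ^ j"
    unfolding d power_add[of bic_q] by (simp only: mult.assoc)
  also have "\<dots> = bic_q ^ i * bic_p ^ j"
    by (simp add: bic_p_power_q_power d power_add)
  finally show ?thesis using d by (simp add: qp_def Elem_mult)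
qed

lemma qp_mult_idempotent: "qp i j * qp n n = qp (i + (n - j)) (max n j)"
proof (cases "j \<le> n")
  case True
  then obtain d where d: "n = j + d" by (metis le_add_diff_inverse)
  have "bic_q ^ i * bic_p ^ j * (bic_q ^ n * bic_p ^ n)
      = bic_q ^ i * (bic_p ^ j * bic_q ^ j * bic_q ^ d) * bic_p ^ n"
    unfolding d power_add[of bic_q] by (simp only: mult.assoc)
  also have "\<dots> = bic_q ^ (i + d) * bic_p ^ n"
    by (simp add: bic_p_power_q_power power_add)
  finally show ?thesis using d by (simp add: qp_def Elem_mult)
next
  case False
  then obtain d where d: "j = d + n" by (metis nat_le_linear le_add_diff_inverse2)
  have "bic_q ^ i * bic_p ^ j * (bic_q ^ n * bic_p ^ n)
      = bic_q ^ i * (bic_p ^ d * (bic_p ^ n * bic_q ^ n) * bic_p ^ n)"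
    unfolding d power_add[of bic_p] by (simp only: mult.assoc)
  also have "\<dots> = bic_q ^ i * bic_p ^ j"
    by (simp add: bic_p_power_q_power d power_add)
  finally show ?thesis using d by (simp add: qp_def Elem_mult)
qed


section \<open>The quarter plane grid\<close>

text \<open>The complement of a large box is connected in the grid: every point with \<open>i \<ge> N\<close> lies on a
  vertical line through \<open>(i, N)\<close>, every point with \<open>j \<ge> N\<close> on a horizontal line through \<open>(N, j)\<close>,
  and neither line meets the box. So a set with finite edge boundary is constant outside a box that
  contains the boundary.\<close>

lemma grid_one_ended:
  fixes P :: "nat \<Rightarrow> nat \<Rightarrow> bool"
  assumes "finite {(i, j). P i j \<noteq> P (Suc i) j}" "finite {(i, j). P i j \<noteq> P i (Suc j)}"
  shows "finite {(i, j). P i j} \<or> finite {(i, j). \<not> P i j}"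
proof -
  let ?B = "{(i, j). P i j \<noteq> P (Suc i) j} \<union> {(i, j). P i j \<noteq> P i (Suc j)}"
  have "finite (fst ` ?B \<union> snd ` ?B)" using assms by simp
  then obtain N where N: "\<forall>n \<in> fst ` ?B \<union> snd ` ?B. n < N"
    unfolding finite_nat_set_iff_bounded by blast
  have inside: "i < N \<and> j < N" if "(i, j) \<in> ?B" for i j
  proof -
    have "fst (i, j) \<in> fst ` ?B" "snd (i, j) \<in> snd ` ?B" using that by (rule imageI)+
    with N show ?thesis by (simp only: fst_conv snd_conv) blast
  qed
  have row: "P (Suc i) j = P i j" and col: "P i (Suc j) = P i j" if "N \<le> i \<or> N \<le> j" for i j
  proof -
    have "(i, j) \<notin> ?B" using inside that by (meson not_le)
    then show "P (Suc i) j = P i j" "P i (Suc j) = P i j" by blast+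
  qed
  have line: "Q m = Q n" if "\<And>k. Q (Suc k) = Q k" for Q :: "nat \<Rightarrow> bool" and m n
  proof -
    have "Q k = Q 0" for k by (induction k) (simp_all add: that)
    then show ?thesis by metis
  qed
  have vertical: "P i j = P i N" if "N \<le> i" for i j
    using line[of "P i"] col that by blast
  have horizontal: "P i j = P N j" if "N \<le> j" for i j
    using line[of "\<lambda>i. P i j"] row that by blast
  have const: "P i j = P N N" if "N \<le> i \<or> N \<le> j" for i j
    using that vertical horizontal by (metis order_refl)
  then have box: "i < N \<and> j < N" if "P i j \<noteq> P N N" for i j
    using that by (meson not_le)
  have fin: "finite ({..<N} \<times> {..<N})" by simp
  show ?thesis
  proof (cases "P N N")
    case True
    then have "{(i, j). \<not> P i j} \<subseteq> {..<N} \<times> {..<N}"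
      using box by auto
    then show ?thesis using fin finite_subset by blast
  next
    case False
    then have "{(i, j). P i j} \<subseteq> {..<N} \<times> {..<N}"
      using box by auto
    then show ?thesis using fin finite_subset by blast
  qed
qed

text \<open>The two sets of edges that leave \<open>U\<close> in each direction are counted from their endpoint in \<open>U\<close>;
  this is where the translations by \<open>p\<close> and by \<open>q\<close> are both needed.\<close>

lemma almost_invariant_finite_or_cofinite:
  fixes U :: "bicyclic0 set"
  assumes left: "\<And>a. finite {x \<in> U. a * x \<notin> U}"
    and right: "\<And>a. finite {x \<in> U. x * a \<notin> U}"
  shows "finite U \<or> finite (range Elem - U)"
proof -
  let ?P = "\<lambda>i j. qp i j \<in> U"
  have pull: "finite {(i, j). qp (f i) (g j) \<in> S}"
    if "finite S" "inj f" "inj g" for S and f g :: "nat \<Rightarrow> nat"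
  proof -
    have "inj (\<lambda>(i, j). qp (f i) (g j))"
      unfolding inj_def using inj_eq[OF that(2)] inj_eq[OF that(3)] by (simp add: split_paired_all)
    from finite_vimageI[OF \<open>finite S\<close> this] show ?thesis
      by (simp add: vimage_def case_prod_unfold)
  qed
  have row: "finite {(i, j). ?P i j \<noteq> ?P (Suc i) j}"
  proof (rule finite_subset)
    show "{(i, j). ?P i j \<noteq> ?P (Suc i) j} \<subseteq>
        {(i, j). qp (id i) (id j) \<in> {x \<in> U. Elem bic_q * x \<notin> U}} \<union>
        {(i, j). qp (Suc i) (id j) \<in> {x \<in> U. Elem bic_p * x \<notin> U}}"
      by (auto simp: q_mult_qp p_mult_qp)
  qed (intro finite_UnI pull left inj_on_id inj_Suc)
  have col: "finite {(i, j). ?P i j \<noteq> ?P i (Suc j)}"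
  proof (rule finite_subset)
    show "{(i, j). ?P i j \<noteq> ?P i (Suc j)} \<subseteq>
        {(i, j). qp (id i) (id j) \<in> {x \<in> U. x * Elem bic_p \<notin> U}} \<union>
        {(i, j). qp (id i) (Suc j) \<in> {x \<in> U. x * Elem bic_q \<notin> U}}"
      by (auto simp: qp_mult_p qp_mult_q)
  qed (intro finite_UnI pull right inj_on_id inj_Suc)
  from grid_one_ended[OF row col] show ?thesis
  proof
    assume "finite {(i, j). ?P i j}"
    moreover have "U \<subseteq> insert 0 ((\<lambda>(i, j). qp i j) ` {(i, j). ?P i j})"
    proof
      fix x assume "x \<in> U"
      then show "x \<in> insert 0 ((\<lambda>(i, j). qp i j) ` {(i, j). ?P i j})"
        by (cases x rule: zero_or_qp) auto
    qed
    ultimately show ?thesis by (meson finite_imageI finite_insert finite_subset)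
  next
    assume "finite {(i, j). \<not> ?P i j}"
    moreover have "range Elem - U \<subseteq> (\<lambda>(i, j). qp i j) ` {(i, j). \<not> ?P i j}"
    proof
      fix x assume "x \<in> range Elem - U"
      then show "x \<in> (\<lambda>(i, j). qp i j) ` {(i, j). \<not> ?P i j}"
        by (cases x rule: zero_or_qp) (auto simp: zero_with_zero_def)
    qed
    ultimately show ?thesis by (meson finite_imageI finite_subset)
  qed
qed


section \<open>Isolated points\<close>

lemma openin_singleton_of_finite:
  assumes "Hausdorff_space X" "openin X S" "finite S" "x \<in> S"
  shows "openin X {x}"
proof -
  have "closedin X (S - {x})"
    using assms by (intro closedin_Hausdorff_finite) (auto dest: openin_subset)
  with assms(2) have "openin X (S - (S - {x}))" by (rule openin_diff)
  moreover have "S - (S - {x}) = {x}" using assms(4) by blast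
  ultimately show ?thesis by simp
qed

lemma finite_compactin_isolated:
  assumes "compactin X K" "\<And>x. x \<in> K \<Longrightarrow> openin X {x}"
  shows "finite K"
proof -
  have "K \<inter> X derived_set_of K = {}"
    using assms(2) by (fastforce simp: in_derived_set_of)
  with assms(1) show ?thesis by (simp add: discrete_compactin_eq_finite)
qed

lemma openin_moved_points:
  assumes "Hausdorff_space X" "topspace X = UNIV" "continuous_map X X f"
  shows "openin X {x. f x \<noteq> x}"
proof -
  have "closedin X {x \<in> topspace X. f x = x}"
    using closedin_continuous_maps_eq[OF assms(1,3) continuous_map_id] by simp
  moreover have "UNIV - {x. f x = x} = {x. f x \<noteq> x}" by blast
  ultimately show ?thesis using assms(2) by (simp add: closedin_def)
qed

text \<open>The points moved by \<open>q\<^sup>n p\<^sup>n\<close> from the left, \<open>n = i + 1\<close>, and by \<open>q\<^sup>m p\<^sup>m\<close> from the right,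
  \<open>m = j + 1\<close>, are those in the box \<open>{..i} \<times> {..j}\<close>, of which \<open>(i, j)\<close> is the corner. The zero is
  fixed and so drops out.\<close>

lemma openin_singleton_qp:
  assumes "Hausdorff_space \<tau>" "semitopological_semigroup \<tau>"
  shows "openin \<tau> {qp i j}"
proof -
  let ?L = "{x. qp (Suc i) (Suc i) * x \<noteq> x}" and ?R = "{x. x * qp (Suc j) (Suc j) \<noteq> x}"
  have box: "?L \<inter> ?R \<subseteq> (\<lambda>(k, l). qp k l) ` ({..i} \<times> {..j})"
  proof
    fix x assume x: "x \<in> ?L \<inter> ?R"
    show "x \<in> (\<lambda>(k, l). qp k l) ` ({..i} \<times> {..j})"
    proof (cases x rule: zero_or_qp)
      case (2 k l)
      have "k \<le> i" "l \<le> j"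
        using x 2 by (auto simp: idempotent_mult_qp qp_mult_idempotent max_def not_less_eq_eq split: if_splits)
      with 2 show ?thesis by auto
    qed (use x in simp)
  qed
  have "openin \<tau> (?L \<inter> ?R)"
    using assms by (intro openin_Int openin_moved_points) (simp_all add: semitopological_semigroup_def)
  moreover have "finite (?L \<inter> ?R)" by (rule finite_subset[OF box]) simp
  moreover have "qp i j \<in> ?L \<inter> ?R"
    by (simp add: idempotent_mult_qp qp_mult_idempotent)
  ultimately show ?thesis by (rule openin_singleton_of_finite[OF assms(1)])
qed


section \<open>Neighbourhoods of zero\<close>

lemma nhds_zero_almost_invariant:
  fixes a :: "'a::semigroup_mult with_zero"
  assumes semi: "semitopological_semigroup \<tau>"
    and U: "openin \<tau> U" "0 \<in> U"
    and almost: "\<And>V. openin \<tau> V \<Longrightarrow> 0 \<in> V \<Longrightarrow> finite (U - V)"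
  shows "finite {x \<in> U. a * x \<notin> U}" "finite {x \<in> U. x * a \<notin> U}"
proof -
  have pre: "finite {x \<in> U. f x \<notin> U}" if "continuous_map \<tau> \<tau> f" "f 0 = 0" for f
  proof -
    have "openin \<tau> {x. f x \<in> U}"
      using openin_continuous_map_preimage[OF that(1) U(1)] semi
      by (simp add: semitopological_semigroup_def)
    then have "finite (U - {x. f x \<in> U})" using almost U(2) that(2) by simp
    moreover have "U - {x. f x \<in> U} = {x \<in> U. f x \<notin> U}" by blast
    ultimately show ?thesis by simp
  qed
  show "finite {x \<in> U. a * x \<notin> U}" "finite {x \<in> U. x * a \<notin> U}"
    using semi by (auto intro!: pre simp: semitopological_semigroup_def)
qed

theorem theorem2p9:
  fixes \<tau> :: "bicyclic0 topology"
  assumes "Hausdorff_space \<tau>"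
    and "locally_compact_space \<tau>"
    and "semitopological_semigroup \<tau>"
  shows "\<tau> = discrete_topology UNIV \<or> topologically_isomorphic \<tau> tau_Ac"
proof -
  have top: "topspace \<tau> = UNIV"
    using assms(3) by (simp add: semitopological_semigroup_def)
  have isolated: "openin \<tau> {x}" if "x \<noteq> 0" for x
    using that openin_singleton_qp[OF assms(1,3)] by (cases x rule: zero_or_qp) auto
  have "0 \<in> topspace \<tau>" by (simp add: top)
  with assms(2) obtain U K where UK: "openin \<tau> U" "compactin \<tau> K" "0 \<in> U" "U \<subseteq> K"
    unfolding locally_compact_space_def by meson
  have almost: "finite (U - V)" if V: "openin \<tau> V" "0 \<in> V" for V
  proof -
    have "closedin \<tau> (UNIV - V)" using closedin_diff[OF closedin_topspace V(1)] top by simp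
    then have "compactin \<tau> (K \<inter> (UNIV - V))" by (rule compact_Int_closedin[OF UK(2)])
    then have "finite (K \<inter> (UNIV - V))"
    proof (rule finite_compactin_isolated)
      fix x assume "x \<in> K \<inter> (UNIV - V)"
      with V(2) have "x \<noteq> 0" by auto
      then show "openin \<tau> {x}" by (rule isolated)
    qed
    then show ?thesis using UK(4) by (auto elim: rev_finite_subset)
  qed
  from nhds_zero_almost_invariant[OF assms(3) UK(1,3) almost]
  have "finite U \<or> finite (range Elem - U)"
    by (rule almost_invariant_finite_or_cofinite)
  then show ?thesis
  proof
    assume "finite U"
    then have "openin \<tau> {0}"
      using openin_singleton_of_finite[OF assms(1) UK(1)] UK(3) by blast
    then have "openin \<tau> {x}" for x using isolated by (cases "x = 0") auto
    then show ?thesis using top discrete_topology_unique[of UNIV \<tau>] by simp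
  next
    assume cofinite: "finite (range Elem - U)"
    have "openin \<tau> V \<longleftrightarrow> openin tau_Ac V" for V
    proof
      assume V: "openin \<tau> V"
      have "finite (range Elem - V)" if "0 \<in> V"
        using finite_subset[of "range Elem - V" "(range Elem - U) \<union> (U - V)"]
          cofinite almost[OF V that] by blast
      then show "openin tau_Ac V" by (simp add: openin_tau_Ac)
    next
      assume V: "openin tau_Ac V"
      show "openin \<tau> V"
      proof (cases "0 \<in> V")
        case True
        then have "finite (range Elem - V)" using V by (simp add: openin_tau_Ac)
        then have "closedin \<tau> (range Elem - V)"
          by (simp add: closedin_Hausdorff_finite[OF assms(1)] top)
        moreover have "UNIV - (range Elem - V) = V"
        proof -
          have "x \<in> V" if "x \<notin> range Elem" for x
            using that True by (cases x) (auto simp: zero_with_zero_def)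
          then show ?thesis by blast
        qed
        ultimately show ?thesis using top by (simp add: closedin_def)
      next
        case False
        have "\<exists>T. openin \<tau> T \<and> x \<in> T \<and> T \<subseteq> V" if "x \<in> V" for x
          using that False isolated[of x] by (intro exI[of _ "{x}"]) auto
        then show ?thesis by (subst openin_subopen) blast
      qed
    qed
    then have "\<tau> = tau_Ac" by (simp add: topology_eq)
    then have "topologically_isomorphic \<tau> tau_Ac"
      unfolding topologically_isomorphic_def by (intro exI[of _ id]) simp
    then show ?thesis ..
  qed
qed

end
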